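(* Let $t_1, \ldots, t_m$ and $p_1, \ldots, p_m$ be nonzero complex numbers, and let $$f(z) = z (z - t_1)^{p_1} \cdots (z - t_m)^{p_m} e^z.$$ Then the Taylor series for the inverse of $f$ around $0$ is $$f^{-1}(z) = \sum_{n=1}^\infty \frac{(-n)^{n-1}}{n!} (-t_1)^{-n p_1} \cdots (-t_m)^{-n p_m} F_n z^n,$$ where $$F_n = {}^{1+1}F_{0+0}\left(\begin{array}{lll} 1-n & ;\ n p_1, \ldots, n p_m & ; \\ & ; & ; \end{array} \frac{1}{n t_1}, \ldots, \frac{1}{n t_m}\right) = \sum_{k_1, \ldots, k_m = 0}^\infty \frac{(1-n)_{k_1 + \cdots + k_m} (np_1)_{k_1} \cdots (np_m)_{k_m}}{k_1! \cdots k_m! \, (nt_1)^{k_1} \cdots (nt_m)^{k_m}}$$ is a generalized Kampé de Fériet function, a limiting case of the Lauricella function. This function always reduces to a polynomial of degree $n$.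
   Context: For $a \in \mathbb{C}$ and an integer $k \ge 0$, $(a)_k = a(a+1)\cdots(a+k-1)$ is the Pochhammer symbol (rising factorial), with $(a)_0 = 1$. The function $f$ is defined by the principal value of the displayed product, and $(-t_i)^{-np_i}$ is likewise a principal value. $f^{-1}$ denotes the inverse of $f$ near $0$, with $f^{-1}(0)=0$. The generalized (Lauricella–)Kampé de Fériet function of $m$ variables used here is $${}^{1+1}F_{0+0}\left(\begin{array}{lll} a & ;\ b_1, \ldots, b_m & ; \\ & ; & ; \end{array} x_1, \ldots, x_m\right) = \sum_{k_1, \ldots, k_m = 0}^\infty (a)_{k_1+\cdots+k_m} \prod_{j=1}^m (b_j)_{k_j} \frac{x_j^{k_j}}{k_j!}.$$ The Lauricella function referred to is the fourth one, $$F_D^{(m)}[a, b_1, \ldots, b_m; c; x_1, \ldots, x_m] = \sum_{k_1, \ldots, k_m = 0}^\infty \frac{(a)_{k_1+\cdots+k_m} (b_1)_{k_1} \cdots (b_m)_{k_m}}{(c)_{k_1+\cdots+k_m}} \frac{x_1^{k_1}}{k_1!} \cdots \frac{x_m^{k_m}}{k_m!}.$$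
   Formalization: Degree is at most n−1 (exactly n−1 unless all np_j = −a_j, a_j naturals with sum < n−1), not n: F_1 = 1. Principal-value f is treated only if the sum of p_j over t_j > 0 is an integer (else discontinuous at 0); the analytic branch is treated always. *)

theory Defs
  imports "HOL-Complex_Analysis.Complex_Analysis"
begin

text \<open>
  The parameters \<open>t\<^sub>1, \<dots>, t\<^sub>m\<close>, \<open>p\<^sub>1, \<dots>, p\<^sub>m\<close> are functions on a finite index type \<open>'m\<close>, and a
  multi-index \<open>(k\<^sub>1, \<dots>, k\<^sub>m)\<close> is a function \<open>'m \<Rightarrow> nat\<close>.
\<close>

definition principal_fun ::
  "('m::finite \<Rightarrow> complex) \<Rightarrow> ('m \<Rightarrow> complex) \<Rightarrow> complex \<Rightarrow> complex" where
  "principal_fun t p z = z * (\<Prod>j\<in>UNIV. (z - t j) powr p j) * exp z"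

text \<open>
  If \<open>t\<^sub>j\<close> is a positive real number, then \<open>z - t\<^sub>j\<close> crosses the branch cut of the logarithm as \<open>z\<close>
  moves around \<open>0\<close>.  The product of principal values then jumps across the real axis by the
  factor \<open>exp (2 \<pi> \<i> s)\<close> or its inverse, where \<open>s\<close> is the sum of the \<open>p\<^sub>j\<close> with \<open>t\<^sub>j > 0\<close>.
  So it is analytic near \<open>0\<close> exactly if \<open>s\<close> is an integer, in particular if no \<open>t\<^sub>j\<close> is a
  positive real number.
\<close>

definition principal_regular :: "('m::finite \<Rightarrow> complex) \<Rightarrow> ('m \<Rightarrow> complex) \<Rightarrow> bool" where
  "principal_regular t p \<longleftrightarrow> (\<Sum>j | - t j \<in> \<real>\<^sub>\<le>\<^sub>0. p j) \<in> \<int>"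

text \<open>
  The branch of the same product that is analytic near \<open>0\<close> for all nonzero \<open>t\<^sub>j\<close>, where the value
  of the \<open>j\<close>-th factor at \<open>0\<close> is the principal value of \<open>(-t\<^sub>j)\<^bsup>p\<^sub>j\<^esup>\<close>.  Near \<open>0\<close> it agrees
  with \<^const>\<open>principal_fun\<close> on the closed upper half-plane, and on a full neighbourhood of \<open>0\<close> if
  \<^const>\<open>principal_regular\<close> holds.
\<close>

definition branch_fun ::
  "('m::finite \<Rightarrow> complex) \<Rightarrow> ('m \<Rightarrow> complex) \<Rightarrow> complex \<Rightarrow> complex" where
  "branch_fun t p z = z * (\<Prod>j\<in>UNIV. (- t j) powr p j * (1 - z / t j) powr p j) * exp z"

definition is_inverse_near_0 :: "(complex \<Rightarrow> complex) \<Rightarrow> (complex \<Rightarrow> complex) \<Rightarrow> bool" where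
  "is_inverse_near_0 f g \<longleftrightarrow> g 0 = 0 \<and>
     (\<exists>U V. open U \<and> open V \<and> 0 \<in> U \<and> 0 \<in> V \<and> homeomorphism U V f g)"

definition kampe_de_feriet ::
  "complex \<Rightarrow> ('m::finite \<Rightarrow> complex) \<Rightarrow> ('m \<Rightarrow> complex) \<Rightarrow> complex" where
  "kampe_de_feriet a b x =
     (\<Sum>\<^sub>\<infinity>k::'m \<Rightarrow> nat. pochhammer a (\<Sum>j\<in>UNIV. k j) *
        (\<Prod>j\<in>UNIV. pochhammer (b j) (k j) * (x j ^ k j / fact (k j))))"

definition lauricella_FD ::
  "complex \<Rightarrow> ('m::finite \<Rightarrow> complex) \<Rightarrow> complex \<Rightarrow> ('m \<Rightarrow> complex) \<Rightarrow> complex" where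
  "lauricella_FD a b c x =
     (\<Sum>\<^sub>\<infinity>k::'m \<Rightarrow> nat.
        pochhammer a (\<Sum>j\<in>UNIV. k j) * (\<Prod>j\<in>UNIV. pochhammer (b j) (k j)) /
        pochhammer c (\<Sum>j\<in>UNIV. k j) * (\<Prod>j\<in>UNIV. x j ^ k j / fact (k j)))"

definition kdf_F :: "('m::finite \<Rightarrow> complex) \<Rightarrow> ('m \<Rightarrow> complex) \<Rightarrow> nat \<Rightarrow> complex" where
  "kdf_F t p n =
     kampe_de_feriet (1 - of_nat n) (\<lambda>j. of_nat n * p j) (\<lambda>j. 1 / (of_nat n * t j))"

text \<open>
  Polynomial functions in the variables \<open>x\<^sub>j\<close>, represented by a coefficient function of finite
  support on multi-indices; the degree is the total degree.
\<close>

definition mpoly_repr ::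
  "(('m::finite \<Rightarrow> nat) \<Rightarrow> complex) \<Rightarrow> (('m \<Rightarrow> complex) \<Rightarrow> complex) \<Rightarrow> bool" where
  "mpoly_repr c h \<longleftrightarrow> finite {k. c k \<noteq> 0} \<and>
     (\<forall>x. h x = (\<Sum>k | c k \<noteq> 0. c k * (\<Prod>j\<in>UNIV. x j ^ k j)))"

definition mpoly_fun_degree_le :: "nat \<Rightarrow> (('m::finite \<Rightarrow> complex) \<Rightarrow> complex) \<Rightarrow> bool" where
  "mpoly_fun_degree_le d h \<longleftrightarrow>
     (\<exists>c. mpoly_repr c h \<and> (\<forall>k. c k \<noteq> 0 \<longrightarrow> (\<Sum>j\<in>UNIV. k j) \<le> d))"

definition mpoly_fun_degree_eq :: "nat \<Rightarrow> (('m::finite \<Rightarrow> complex) \<Rightarrow> complex) \<Rightarrow> bool" where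
  "mpoly_fun_degree_eq d h \<longleftrightarrow>
     (\<exists>c. mpoly_repr c h \<and> (\<forall>k. c k \<noteq> 0 \<longrightarrow> (\<Sum>j\<in>UNIV. k j) \<le> d) \<and>
          (\<exists>k. c k \<noteq> 0 \<and> (\<Sum>j\<in>UNIV. k j) = d))"

end

theory Submission
  imports Defs
begin

text \<open>
  The function \<open>f\<close> is \<open>z\<close> times a factor \<open>\<phi>\<close> that is analytic and nonzero at \<open>0\<close>, so Lagrange inversion
  gives the \<open>n\<close>-th coefficient of the inverse as \<open>1/n\<close> times the coefficient of \<open>z\<^sup>n\<^sup>-\<^sup>1\<close> in \<open>\<phi>\<close>
  to the power \<open>-n\<close>.  This power of \<open>\<phi>\<close> is a constant times a product of binomial series and
  \<open>exp (- n z)\<close>.  Its coefficient is a sum over the multi-indices of size \<open>\<le> n - 1\<close>, where a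
  multi-index of size \<open>s\<close> contributes the factor \<open>(- n)\<^bsup>n-1-s\<^esup> / (n-1-s)!\<close> from the exponential.
  Since the Pochhammer symbol \<open>(1-n)\<^sub>s\<close> equals \<open>(-1)\<^sup>s (n-1)! / (n-1-s)!\<close>, this is the Kampe de
  Feriet sum up to the factor \<open>(- n)\<^sup>n\<^sup>-\<^sup>1 / (n-1)!\<close> (lemma \<open>nth_prod_times_exp\<close>).

  Lagrange inversion is proved for formal power series (\<open>lagrange_inversion_fps\<close>) and carried over
  to every local inverse of an analytic function (\<open>lagrange_inversion_analytic\<close>), since such an
  inverse is itself analytic.  The product of principal values agrees with the analytic branch near
  \<open>0\<close>, because below the real axis each \<open>t\<^sub>j > 0\<close> contributes the factor \<open>exp (- 2 \<pi> \<i> p\<^sub>j)\<close>, and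
  these factors multiply to \<open>1\<close> when the sum of the corresponding \<open>p\<^sub>j\<close> is an integer
  (\<open>principal_fun_eq_branch_fun\<close>).

  The remaining claims hold because \<open>(1-n)\<^sub>s\<close> vanishes for \<open>s \<ge> n\<close>, so that all the multiple series
  are finite sums.  The limit of the Lauricella function can then be taken term by term, and the
  degree \<open>n - 1\<close> is attained exactly if some multi-index of size \<open>n - 1\<close> annihilates none of the
  symbols \<open>(n p\<^sub>j)\<^sub>k\<close>.
\<close>

section \<open>Lagrange inversion\<close>

lemma fps_power_inverse_power:
  fixes A :: "'a::field fps"
  assumes "fps_nth A 0 \<noteq> 0" "i \<le> n"
  shows "inverse A ^ n * A ^ i = inverse A ^ (n - i)"
proof -
  have "inverse A ^ n = inverse A ^ (n - i) * inverse A ^ i"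
    using assms(2) by (simp flip: power_add)
  then have "inverse A ^ n * A ^ i = inverse A ^ (n - i) * (inverse A * A) ^ i"
    by (simp add: power_mult_distrib mult.assoc)
  then show ?thesis
    using inverse_mult_eq_1[OF assms(1)] by simp
qed

text \<open>
  With \<open>F = X \<Phi>\<close>, the coefficient below is the residue of \<open>F\<^sup>i F' / F\<^sup>n\<close>, which is a derivative
  unless \<open>i = n - 1\<close>.
\<close>

lemma lagrange_residue:
  fixes \<Phi> :: "'a::field_char_0 fps"
  assumes \<Phi>: "fps_nth \<Phi> 0 \<noteq> 0"
  defines "F \<equiv> fps_X * \<Phi>"
  assumes "i < n"
  shows "fps_nth (inverse \<Phi> ^ n * (F ^ i * fps_deriv F)) (n - 1) = (if i = n - 1 then 1 else 0)"
proof -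
  define r where "r = n - Suc i"
  have n: "n = Suc (i + r)"
    using assms(3) by (simp add: r_def)
  have dF: "fps_deriv F = \<Phi> + fps_X * fps_deriv \<Phi>"
    by (simp add: F_def)
  have 1: "inverse \<Phi> ^ Suc r * \<Phi> = inverse \<Phi> ^ r"
    using fps_power_inverse_power[OF \<Phi>, of 1 "Suc r"] by simp
  have "inverse \<Phi> ^ n * (F ^ i * fps_deriv F) =
        fps_X ^ i * ((inverse \<Phi> ^ n * \<Phi> ^ i) * fps_deriv F)"
    by (simp add: F_def power_mult_distrib mult_ac)
  also have "inverse \<Phi> ^ n * \<Phi> ^ i = inverse \<Phi> ^ Suc r"
    using fps_power_inverse_power[OF \<Phi>, of i n] by (simp add: n Suc_diff_le)
  also have "inverse \<Phi> ^ Suc r * fps_deriv F =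
             inverse \<Phi> ^ r + fps_X * (inverse \<Phi> ^ Suc r * fps_deriv \<Phi>)"
    unfolding dF by (simp only: distrib_left 1 mult.left_commute)
  finally have eq: "fps_nth (inverse \<Phi> ^ n * (F ^ i * fps_deriv F)) (n - 1) =
      fps_nth (inverse \<Phi> ^ r + fps_X * (inverse \<Phi> ^ Suc r * fps_deriv \<Phi>)) r"
    by (simp add: n fps_X_power_mult_nth)
  show ?thesis
  proof (cases r)
    case 0
    then show ?thesis using eq n by simp
  next
    case (Suc q)
    \<comment> \<open>The coefficients of \<open>X\<^sup>r\<close> in the two summands cancel: the derivative of the first summand,
      times \<open>X\<close>, is \<open>- r\<close> times the second.\<close>
    have "fps_deriv (inverse \<Phi> ^ r) = - fps_const (of_nat r) * (inverse \<Phi> ^ Suc r * fps_deriv \<Phi>)"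
      unfolding fps_deriv_power fps_inverse_deriv[OF \<Phi>] Suc diff_Suc_1
      by (simp only: power_Suc power2_eq_square mult_minus_left mult_minus_right mult_ac)
    then have "fps_nth (fps_deriv (inverse \<Phi> ^ r)) q =
               fps_nth (- fps_const (of_nat r) * (inverse \<Phi> ^ Suc r * fps_deriv \<Phi>)) q"
      by simp
    then have "of_nat r * fps_nth (inverse \<Phi> ^ r) r =
               of_nat r * - fps_nth (inverse \<Phi> ^ Suc r * fps_deriv \<Phi>) q"
      unfolding fps_deriv_nth by (simp only: minus_mult_left[symmetric] fps_neg_nth fps_mult_left_const_nth) (simp add: Suc)
    then have "fps_nth (inverse \<Phi> ^ r) r = - fps_nth (inverse \<Phi> ^ Suc r * fps_deriv \<Phi>) q"
      using Suc by (simp only: mult_cancel_left of_nat_eq_0_iff) blast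
    then show ?thesis
      using eq n Suc by (simp only: fps_add_nth fps_mult_fps_X_commute fps_X_mult_nth) simp
  qed
qed

text \<open>
  Differentiating \<open>G \<circ> F = X\<close> gives \<open>(G' \<circ> F) F' = 1\<close>.  Division by \<open>F\<^sup>n\<close> and comparison of residues
  isolates the coefficient of \<open>X\<^sup>n\<^sup>-\<^sup>1\<close> in \<open>G'\<close>.
\<close>

theorem lagrange_inversion_fps:
  fixes \<Phi> G :: "'a::field_char_0 fps"
  assumes \<Phi>: "fps_nth \<Phi> 0 \<noteq> 0"
    and inv: "fps_compose G (fps_X * \<Phi>) = fps_X"
    and n: "n \<ge> 1"
  shows "fps_nth G n = fps_nth (inverse \<Phi> ^ n) (n - 1) / of_nat n"
proof -
  define F where "F = fps_X * \<Phi>"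
  have F0: "fps_nth F 0 = 0"
    by (simp add: F_def)
  \<comment> \<open>Only the coefficients below \<open>n\<close> of \<open>G' \<circ> F\<close> matter, so the infinite sum may be truncated.\<close>
  define S where "S = (\<Sum>i<n. fps_const (fps_nth (fps_deriv G) i) * F ^ i)"
  have trunc: "fps_nth (fps_compose (fps_deriv G) F) m = fps_nth S m" if "m < n" for m
  proof -
    have "fps_nth S m = (\<Sum>i<n. fps_nth (fps_deriv G) i * fps_nth (F ^ i) m)"
      by (simp add: S_def fps_sum_nth)
    also have "\<dots> = (\<Sum>i\<in>{0..m}. fps_nth (fps_deriv G) i * fps_nth (F ^ i) m)"
      by (rule sum.mono_neutral_right) (use that startsby_zero_power_prefix[OF F0] in auto)
    finally show ?thesis
      by (simp add: fps_compose_nth)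
  qed
  have "fps_compose (fps_deriv G) F * fps_deriv F = 1"
    using fps_compose_deriv[OF F0, of G] inv by (simp add: F_def)
  then have "fps_nth (inverse \<Phi> ^ n) (n - 1) =
        fps_nth (fps_compose (fps_deriv G) F * (inverse \<Phi> ^ n * fps_deriv F)) (n - 1)"
    by (metis mult.left_commute mult.right_neutral)
  also have "\<dots> = fps_nth (S * (inverse \<Phi> ^ n * fps_deriv F)) (n - 1)"
    unfolding fps_mult_nth using n by (intro sum.cong refl) (subst trunc, auto)
  also have "S * (inverse \<Phi> ^ n * fps_deriv F) =
      (\<Sum>i<n. fps_const (fps_nth (fps_deriv G) i) * (inverse \<Phi> ^ n * (F ^ i * fps_deriv F)))"
    unfolding S_def sum_distrib_right by (intro sum.cong refl) (simp only: mult_ac)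
  also have "fps_nth \<dots> (n - 1) =
      (\<Sum>i<n. fps_nth (fps_deriv G) i * (if i = n - 1 then 1 else 0))"
    unfolding fps_sum_nth fps_mult_left_const_nth
    using lagrange_residue[OF \<Phi>, folded F_def] by (intro sum.cong refl) auto
  also have "\<dots> = fps_nth (fps_deriv G) (n - 1)"
    using n by (subst sum.mono_neutral_right[of _ "{n - 1}"]) auto
  also have "\<dots> = of_nat n * fps_nth G n"
    using n by simp
  finally show ?thesis
    using n by simp
qed

lemma is_inverse_near_0_exists:
  assumes f: "f has_fps_expansion F" and F: "fps_nth F 0 = 0" "fps_nth F 1 \<noteq> 0"
  shows "\<exists>g. is_inverse_near_0 f g"
proof -
  obtain S where S: "open S" "0 \<in> S" "f holomorphic_on S"
    using has_fps_expansion_imp_holomorphic[OF f] by metis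
  have "deriv f 0 \<noteq> 0"
    using has_fps_expansion_imp_0_eq_fps_nth_0[OF has_fps_expansion_deriv[OF f]] F by simp
  then obtain r where r: "r > 0" "ball 0 r \<subseteq> S" "open (f ` ball 0 r)" "inj_on f (ball 0 r)"
    using has_complex_derivative_locally_invertible[OF S(3,2,1)] by metis
  have hol: "f holomorphic_on ball 0 r"
    using S r holomorphic_on_subset by blast
  obtain g where g: "g holomorphic_on (f ` ball 0 r)" "\<And>z. z \<in> ball 0 r \<Longrightarrow> g (f z) = z"
    using holomorphic_has_inverse[OF hol _ r(4)] by (metis open_ball)
  have f0: "f 0 = 0"
    using has_fps_expansion_imp_0_eq_fps_nth_0[OF f] F by simp
  have "homeomorphism (ball 0 r) (f ` ball 0 r) f g"
    by (rule homeomorphismI)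
      (use g hol in \<open>auto intro: holomorphic_on_imp_continuous_on\<close>)
  moreover have "0 \<in> f ` ball 0 r"
    using f0 r(1) by (metis centre_in_ball image_eqI)
  moreover have "g 0 = 0"
    using g(2)[of 0] f0 r(1) by simp
  ultimately show ?thesis
    unfolding is_inverse_near_0_def using r by (metis centre_in_ball open_ball)
qed

text \<open>
  A local inverse is only assumed to be continuous; it is analytic because it coincides near \<open>0\<close>
  with the holomorphic inverse of an injective holomorphic function.
\<close>

lemma is_inverse_near_0_has_fps_expansion:
  assumes f: "f has_fps_expansion F" and F: "fps_nth F 0 = 0"
    and g: "is_inverse_near_0 f g"
  obtains G where "g has_fps_expansion G" "fps_compose G F = fps_X"
proof -
  obtain S where S: "open S" "0 \<in> S" "f holomorphic_on S"
    using has_fps_expansion_imp_holomorphic[OF f] by metis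
  obtain U V where UV: "open U" "open V" "0 \<in> U" "0 \<in> V" "homeomorphism U V f g"
    using g by (auto simp: is_inverse_near_0_def)
  define A where "A = U \<inter> S"
  have A: "open A" "0 \<in> A" "f holomorphic_on A"
    using S UV by (auto simp: A_def intro: holomorphic_on_subset)
  have gf: "g (f z) = z" if "z \<in> A" for z
    using UV(5) that by (auto simp: A_def homeomorphism_def)
  then have inj: "inj_on f A"
    by (metis inj_onI)
  obtain g' where g': "g' holomorphic_on (f ` A)" "\<And>z. z \<in> A \<Longrightarrow> g' (f z) = z"
    using holomorphic_has_inverse[OF A(3,1) inj] by metis
  have "g holomorphic_on (f ` A)"
    using g'(1) by (rule holomorphic_transform) (use gf g'(2) in auto)
  moreover have "0 \<in> f ` A"
    using A(2) has_fps_expansion_imp_0_eq_fps_nth_0[OF f] F by (metis image_eqI)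
  ultimately have G: "g has_fps_expansion fps_expansion g 0"
    using open_mapping_thm3[OF A(3,1) inj] by blast
  have "(g \<circ> f) has_fps_expansion fps_compose (fps_expansion g 0) F"
    by (rule has_fps_expansion_compose[OF G f F])
  moreover have "eventually (\<lambda>z. (g \<circ> f) z = z) (nhds 0)"
    using eventually_nhds_in_open[OF A(1,2)] by eventually_elim (simp add: gf)
  ultimately have "(\<lambda>z. z) has_fps_expansion fps_compose (fps_expansion g 0) F"
    using has_fps_expansion_cong[of "g \<circ> f" "\<lambda>z. z", OF _ refl] by simp
  then have "fps_compose (fps_expansion g 0) F = fps_X"
    using fps_expansion_unique_complex has_fps_expansion_fps_X by blast
  with G show ?thesis
    using that by blast
qed

theorem lagrange_inversion_analytic:
  fixes \<Phi> :: "complex fps"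
  assumes f: "f has_fps_expansion fps_X * \<Phi>" and \<Phi>: "fps_nth \<Phi> 0 \<noteq> 0"
    and g: "is_inverse_near_0 f g"
  shows "g has_fps_expansion
    Abs_fps (\<lambda>n. if n = 0 then 0 else fps_nth (inverse \<Phi> ^ n) (n - 1) / of_nat n)"
proof -
  have "fps_nth (fps_X * \<Phi>) 0 = 0"
    by simp
  then obtain G where G: "g has_fps_expansion G" "fps_compose G (fps_X * \<Phi>) = fps_X"
    using is_inverse_near_0_has_fps_expansion[OF f _ g] by blast
  have "fps_nth G 0 = 0"
    using has_fps_expansion_imp_0_eq_fps_nth_0[OF G(1)] g by (simp add: is_inverse_near_0_def)
  then have "G = Abs_fps (\<lambda>n. if n = 0 then 0 else fps_nth (inverse \<Phi> ^ n) (n - 1) / of_nat n)"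
    using lagrange_inversion_fps[OF \<Phi> G(2)] by (simp add: fps_eq_iff)
  with G(1) show ?thesis
    by simp
qed

section \<open>Sums over multi-indices\<close>

lemma finite_multi_index_le: "finite {k::'m::finite \<Rightarrow> nat. (\<Sum>j\<in>UNIV. k j) \<le> N}"
proof (rule finite_subset)
  have "k j \<le> N" if "(\<Sum>j\<in>UNIV. k j) \<le> N" for k :: "'m \<Rightarrow> nat" and j
    using member_le_sum[of j UNIV k] that by simp
  then show "{k::'m \<Rightarrow> nat. (\<Sum>j\<in>UNIV. k j) \<le> N} \<subseteq> (\<Pi>\<^sub>E j\<in>UNIV. {..N})"
    by (auto simp: PiE_def)
qed (rule finite_PiE, auto)

lemma multi_index_below:
  fixes a :: "'m::finite \<Rightarrow> nat"
  assumes "N \<le> (\<Sum>j\<in>UNIV. a j)"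
  obtains k where "\<And>j. k j \<le> a j" "(\<Sum>j\<in>UNIV. k j) = N"
proof -
  have "\<exists>k. (\<forall>j. k j \<le> a j) \<and> (\<Sum>j\<in>UNIV. k j) = N"
    using assms
  proof (induction N)
    case 0
    then show ?case by (intro exI[of _ "\<lambda>_. 0"]) auto
  next
    case (Suc N)
    then obtain k where k: "\<forall>j. k j \<le> a j" "(\<Sum>j\<in>UNIV. k j) = N"
      by auto
    obtain i where i: "k i < a i"
      using Suc.prems k sum_mono[of UNIV a k] by (metis not_less not_less_eq_eq)
    have "(\<Sum>j\<in>UNIV. (k(i := Suc (k i))) j) = Suc N"
      using k(2) by (simp add: sum.remove[of UNIV i])
    then show ?case
      using k i by (intro exI[of _ "k(i := Suc (k i))"]) auto
  qed
  with that show ?thesis by blast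
qed

lemma fps_nth_prod_multi_index:
  fixes A :: "'m::finite \<Rightarrow> 'a::comm_ring_1 fps"
  shows "fps_nth (\<Prod>j\<in>UNIV. A j) n =
    (\<Sum>k | (\<Sum>j\<in>UNIV. k j) = n. \<Prod>j\<in>UNIV. fps_nth (A j) (k j))"
proof -
  have size: "size X = (\<Sum>j\<in>UNIV. count X j)" for X :: "'m multiset"
    unfolding size_multiset_overloaded_eq
    by (rule sum.mono_neutral_left) (auto simp: not_in_iff)
  have cnt: "count (Abs_multiset k) = k" for k :: "'m \<Rightarrow> nat"
    by (rule count_Abs_multiset) simp
  have "fps_nth (\<Prod>j\<in>UNIV. A j) n =
      (\<Sum>X\<in>multisets_of_size UNIV n. \<Prod>j\<in>UNIV. fps_nth (A j) (count X j))"
    by (rule fps_prod_nth') simp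
  also have "\<dots> = (\<Sum>k | (\<Sum>j\<in>UNIV. k j) = n. \<Prod>j\<in>UNIV. fps_nth (A j) (k j))"
    by (rule sum.reindex_bij_witness[of _ Abs_multiset count])
      (auto simp: cnt size multisets_of_size_def count_inverse)
  finally show ?thesis .
qed

section \<open>The Kampe de Feriet function\<close>

lemma kdf_term_zero:
  assumes "\<not> (\<Sum>j\<in>UNIV. k j) \<le> N"
  shows "pochhammer (- of_nat N :: complex) (\<Sum>j\<in>UNIV. k j) = 0"
  using assms pochhammer_of_nat_eq_0_lemma[of N "\<Sum>j\<in>UNIV. k j"] by simp

lemma kampe_de_feriet_has_sum:
  fixes b x :: "'m::finite \<Rightarrow> complex"
  shows "((\<lambda>k. pochhammer (- of_nat N) (\<Sum>j\<in>UNIV. k j) *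
      (\<Prod>j\<in>UNIV. pochhammer (b j) (k j) * (x j ^ k j / fact (k j))))
    has_sum kampe_de_feriet (- of_nat N) b x) UNIV"
proof -
  have "(\<lambda>k::'m \<Rightarrow> nat. pochhammer (- of_nat N) (\<Sum>j\<in>UNIV. k j) *
      (\<Prod>j\<in>UNIV. pochhammer (b j) (k j) * (x j ^ k j / fact (k j)))) summable_on UNIV"
    by (rule has_sum_imp_summable, rule has_sum_finite_neutralI[OF finite_multi_index_le[of N]])
      (auto simp: kdf_term_zero)
  then show ?thesis
    unfolding kampe_de_feriet_def by (rule has_sum_infsum)
qed

lemma kampe_de_feriet_finite_sum:
  fixes b x :: "'m::finite \<Rightarrow> complex"
  shows "kampe_de_feriet (- of_nat N) b x =
    (\<Sum>k | (\<Sum>j\<in>UNIV. k j) \<le> N. pochhammer (- of_nat N) (\<Sum>j\<in>UNIV. k j) *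
      (\<Prod>j\<in>UNIV. pochhammer (b j) (k j) * (x j ^ k j / fact (k j))))"
  by (rule has_sum_unique[OF kampe_de_feriet_has_sum],
      rule has_sum_finite_neutralI[OF finite_multi_index_le[of N]]) (auto simp: kdf_term_zero)

lemma lauricella_FD_finite_sum:
  fixes b x :: "'m::finite \<Rightarrow> complex"
  shows "lauricella_FD (- of_nat N) b c x =
    (\<Sum>k | (\<Sum>j\<in>UNIV. k j) \<le> N.
      pochhammer (- of_nat N) (\<Sum>j\<in>UNIV. k j) * (\<Prod>j\<in>UNIV. pochhammer (b j) (k j)) /
      pochhammer c (\<Sum>j\<in>UNIV. k j) * (\<Prod>j\<in>UNIV. x j ^ k j / fact (k j)))"
  unfolding lauricella_FD_def
  by (rule infsumI, rule has_sum_finite_neutralI[OF finite_multi_index_le[of N]])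
    (auto simp: kdf_term_zero)

lemma tendsto_power_over_pochhammer:
  "((\<lambda>c::complex. c ^ m / pochhammer c m) \<longlongrightarrow> 1) at_infinity"
proof (induction m)
  case 0
  then show ?case by simp
next
  case (Suc m)
  have "((\<lambda>c::complex. inverse (1 + of_nat m * inverse c)) \<longlongrightarrow> inverse (1 + of_nat m * 0)) at_infinity"
    by (intro tendsto_intros tendsto_inverse_0) auto
  moreover have "eventually (\<lambda>c::complex. inverse (1 + of_nat m * inverse c) = c / (c + of_nat m)) at_infinity"
    using eventually_not_equal_at_infinity[of 0] by eventually_elim (auto simp: field_simps)
  ultimately have "((\<lambda>c::complex. c / (c + of_nat m)) \<longlongrightarrow> 1) at_infinity"
    using tendsto_cong by force
  from tendsto_mult[OF Suc this] show ?case
    by (simp add: pochhammer_Suc mult_ac)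
qed

lemma lauricella_FD_tendsto_kampe_de_feriet:
  fixes b x :: "'m::finite \<Rightarrow> complex"
  shows "((\<lambda>c. lauricella_FD (- of_nat N) b c (\<lambda>j. c * x j))
    \<longlongrightarrow> kampe_de_feriet (- of_nat N) b x) at_infinity"
proof -
  define C where "C k = pochhammer (- of_nat N) (\<Sum>j\<in>UNIV. k j) *
      (\<Prod>j\<in>UNIV. pochhammer (b j) (k j) * (x j ^ k j / fact (k j)))" for k :: "'m \<Rightarrow> nat"
  have "lauricella_FD (- of_nat N) b c (\<lambda>j. c * x j) =
      (\<Sum>k | (\<Sum>j\<in>UNIV. k j) \<le> N. C k * (c ^ (\<Sum>j\<in>UNIV. k j) / pochhammer c (\<Sum>j\<in>UNIV. k j)))" for c
    unfolding lauricella_FD_finite_sum C_def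
    by (simp add: power_mult_distrib prod.distrib power_sum prod_dividef mult_ac)
  moreover have "((\<lambda>c. \<Sum>k | (\<Sum>j\<in>UNIV. k j) \<le> N.
        C k * (c ^ (\<Sum>j\<in>UNIV. k j) / pochhammer c (\<Sum>j\<in>UNIV. k j)))
      \<longlongrightarrow> (\<Sum>k | (\<Sum>j\<in>UNIV. k j) \<le> N. C k * 1)) at_infinity"
    by (intro tendsto_sum tendsto_mult tendsto_const tendsto_power_over_pochhammer)
  ultimately show ?thesis
    by (simp add: kampe_de_feriet_finite_sum C_def)
qed

text \<open>The coefficient of the monomial with exponent \<open>k\<close> in the terminating function with first parameter \<open>- N\<close>.\<close>

definition kdf_coeff :: "nat \<Rightarrow> ('m::finite \<Rightarrow> complex) \<Rightarrow> ('m \<Rightarrow> nat) \<Rightarrow> complex" where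
  "kdf_coeff N b k = pochhammer (- of_nat N) (\<Sum>j\<in>UNIV. k j) *
     (\<Prod>j\<in>UNIV. pochhammer (b j) (k j) / fact (k j))"

lemma kdf_coeff_nonzero_imp_le: "kdf_coeff N b k \<noteq> 0 \<Longrightarrow> (\<Sum>j\<in>UNIV. k j) \<le> N"
  using kdf_term_zero unfolding kdf_coeff_def by fastforce

lemma mpoly_repr_kampe_de_feriet:
  "mpoly_repr (kdf_coeff N b) (kampe_de_feriet (- of_nat N) b)"
  unfolding mpoly_repr_def
proof (intro conjI allI)
  show "finite {k. kdf_coeff N b k \<noteq> 0}"
    by (rule finite_subset[OF _ finite_multi_index_le[of N]]) (auto dest: kdf_coeff_nonzero_imp_le)
  fix x
  have "kampe_de_feriet (- of_nat N) b x =
      (\<Sum>k | (\<Sum>j\<in>UNIV. k j) \<le> N. kdf_coeff N b k * (\<Prod>j\<in>UNIV. x j ^ k j))"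
    unfolding kampe_de_feriet_finite_sum kdf_coeff_def
    by (simp add: prod.distrib prod_dividef mult_ac)
  also have "\<dots> = (\<Sum>k | kdf_coeff N b k \<noteq> 0. kdf_coeff N b k * (\<Prod>j\<in>UNIV. x j ^ k j))"
    by (rule sum.mono_neutral_right) (auto simp: finite_multi_index_le dest: kdf_coeff_nonzero_imp_le)
  finally show "kampe_de_feriet (- of_nat N) b x =
      (\<Sum>k | kdf_coeff N b k \<noteq> 0. kdf_coeff N b k * (\<Prod>j\<in>UNIV. x j ^ k j))" .
qed

lemma kampe_de_feriet_degree_le:
  "mpoly_fun_degree_le N (kampe_de_feriet (- of_nat N) b)"
  unfolding mpoly_fun_degree_le_def
  using mpoly_repr_kampe_de_feriet kdf_coeff_nonzero_imp_le by blast

text \<open>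
  The condition on \<open>b\<close> is sharp: \<open>(- a\<^sub>j)\<^sub>k\<close> is nonzero only for \<open>k \<le> a\<^sub>j\<close>, so if all \<open>b\<^sub>j\<close> are \<open>- a\<^sub>j\<close>,
  the monomials that occur have total degree at most the sum of the \<open>a\<^sub>j\<close>.
\<close>

lemma kampe_de_feriet_degree_eq:
  fixes b :: "'m::finite \<Rightarrow> complex"
  assumes b: "\<not> (\<exists>a::'m \<Rightarrow> nat. (\<forall>j. b j = - of_nat (a j)) \<and> (\<Sum>j\<in>UNIV. a j) < N)"
  shows "mpoly_fun_degree_eq N (kampe_de_feriet (- of_nat N) b)"
proof -
  have "\<exists>k. (\<forall>j. pochhammer (b j) (k j) \<noteq> 0) \<and> (\<Sum>j\<in>UNIV. k j) = N"
  proof (cases "\<exists>a::'m \<Rightarrow> nat. \<forall>j. b j = - of_nat (a j)")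
    case True
    then obtain a where a: "\<And>j. b j = - of_nat (a j)"
      by blast
    with b have "N \<le> (\<Sum>j\<in>UNIV. a j)"
      by (meson not_le)
    then obtain k where "\<And>j. k j \<le> a j" "(\<Sum>j\<in>UNIV. k j) = N"
      using multi_index_below by blast
    then show ?thesis
      using a pochhammer_of_nat_eq_0_lemma' by metis
  next
    case False
    then obtain i where i: "\<And>m::nat. b i \<noteq> - of_nat m"
      by metis
    have "pochhammer (b i) N \<noteq> 0"
      using i by (simp add: pochhammer_eq_0_iff)
    then show ?thesis
      by (intro exI[of _ "\<lambda>j. if j = i then N else 0"]) auto
  qed
  then obtain k where k: "\<forall>j. pochhammer (b j) (k j) \<noteq> 0" "(\<Sum>j\<in>UNIV. k j) = N"
    by blast
  then have "kdf_coeff N b k \<noteq> 0"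
    using pochhammer_of_nat_eq_0_lemma'[of N N] by (simp add: kdf_coeff_def)
  with k(2) show ?thesis
    unfolding mpoly_fun_degree_eq_def
    using mpoly_repr_kampe_de_feriet kdf_coeff_nonzero_imp_le by blast
qed

section \<open>Expansion of the branch at the origin\<close>

lemma has_fps_expansion_one_minus_powr:
  fixes t c :: complex
  shows "(\<lambda>z. (1 - z / t) powr c) has_fps_expansion Abs_fps (\<lambda>k. pochhammer (- c) k / (fact k * t ^ k))"
proof -
  have "(\<lambda>z. (- 1 / t) * z) has_fps_expansion fps_const (- 1 / t) * fps_X"
    by (rule has_fps_expansion_cmult_left[OF has_fps_expansion_fps_X])
  then have "((\<lambda>x. (1 + x) powr c) \<circ> (\<lambda>z. (- 1 / t) * z)) has_fps_expansion
      fps_compose (fps_binomial c) (fps_const (- 1 / t) * fps_X)"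
    by (intro has_fps_expansion_compose has_fps_expansion_binomial_complex) simp_all
  moreover have "fps_compose (fps_binomial c) (fps_const (- 1 / t) * fps_X) =
      Abs_fps (\<lambda>k. pochhammer (- c) k / (fact k * t ^ k))"
  proof (rule fps_ext)
    fix k
    have "(-1::complex) ^ k * (-1) ^ k = 1"
      by (simp flip: power_mult_distrib)
    then show "fps_nth (fps_compose (fps_binomial c) (fps_const (- 1 / t) * fps_X)) k =
        fps_nth (Abs_fps (\<lambda>k. pochhammer (- c) k / (fact k * t ^ k))) k"
      unfolding fps_compose_linear fps_nth_Abs_fps fps_binomial_nth gbinomial_pochhammer power_divide
      by (simp flip: mult.assoc)
  qed
  ultimately show ?thesis
    by (simp add: o_def)
qed

text \<open>The factor \<open>\<phi>\<close> with \<^term>\<open>branch_fun t p z\<close> \<open>= z \<phi>(z)\<close>; it is analytic and nonzero at \<open>0\<close> if all \<open>t\<^sub>j\<close> are nonzero.\<close>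

definition branch_cofactor :: "('m::finite \<Rightarrow> complex) \<Rightarrow> ('m \<Rightarrow> complex) \<Rightarrow> complex \<Rightarrow> complex" where
  "branch_cofactor t p z = (\<Prod>j\<in>UNIV. (- t j) powr p j * (1 - z / t j) powr p j) * exp z"

lemma branch_cofactor_analytic: "branch_cofactor t p analytic_on {0}"
proof -
  have "branch_cofactor t p has_fps_expansion
     (\<Prod>j\<in>UNIV. fps_const ((- t j) powr p j) *
        Abs_fps (\<lambda>k. pochhammer (- p j) k / (fact k * t j ^ k))) * fps_exp 1"
    unfolding branch_cofactor_def
    by (intro fps_expansion_intros has_fps_expansion_one_minus_powr)
  then show ?thesis
    by (rule has_fps_expansion_imp_analytic_0)
qed

text \<open>
  For \<open>n > 0\<close> this holds at every \<open>z\<close>: where a base vanishes, both sides are \<open>0\<close> by the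
  conventions \<open>0 powr c = 0\<close> and \<open>inverse 0 = 0\<close>.
\<close>

lemma inverse_branch_cofactor_power:
  "inverse (branch_cofactor t p z) ^ n =
    (\<Prod>j\<in>UNIV. (- t j) powr (- of_nat n * p j)) *
    ((\<Prod>j\<in>UNIV. (1 - z / t j) powr (- of_nat n * p j)) * exp (- of_nat n * z))" if "n > 0"
proof -
  have powr: "inverse (w powr q) ^ n = w powr (- of_nat n * q)" for w q :: complex
    using that by (auto simp: powr_def power_inverse[symmetric] exp_minus[symmetric]
        exp_of_nat_mult[symmetric] mult_ac)
  have exp: "inverse (exp z) ^ n = exp (- of_nat n * z)"
    by (simp add: exp_minus[symmetric] exp_of_nat_mult[symmetric])
  have "inverse (branch_cofactor t p z) ^ n =
      (\<Prod>j\<in>UNIV. inverse ((- t j) powr p j) ^ n * inverse ((1 - z / t j) powr p j) ^ n)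
      * inverse (exp z) ^ n"
    by (simp add: branch_cofactor_def power_mult_distrib prod_power_distrib flip: prod_inversef)
  then show ?thesis
    unfolding powr exp prod.distrib by (simp add: mult_ac)
qed

lemma inverse_branch_cofactor_power_expansion:
  assumes "n > 0"
  shows "(\<lambda>z. inverse (branch_cofactor t p z) ^ n) has_fps_expansion
    fps_const (\<Prod>j\<in>UNIV. (- t j) powr (- of_nat n * p j)) *
    ((\<Prod>j\<in>UNIV. Abs_fps (\<lambda>k. pochhammer (of_nat n * p j) k / (fact k * t j ^ k))) *
     fps_exp (- of_nat n))"
  unfolding inverse_branch_cofactor_power[OF assms]
  using has_fps_expansion_one_minus_powr[of _ "- (of_nat n * p _)"]
  by (intro fps_expansion_intros) simp_all

lemma pochhammer_minus_of_nat_eq_fact: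
  assumes "k \<le> N"
  shows "pochhammer (- of_nat N :: 'a::field_char_0) k = (-1) ^ k * fact N / fact (N - k)"
  using pochhammer_product[of "N - k" N "1 :: 'a"] assms
  by (simp add: pochhammer_minus of_nat_diff pochhammer_fact[symmetric] field_simps)

text \<open>The coefficient of the inverse function, up to the factor \<open>1/n\<close> and the constants \<open>(- t\<^sub>j)\<close> to the power \<open>- n p\<^sub>j\<close>.\<close>

lemma nth_prod_times_exp:
  fixes t p :: "'m::finite \<Rightarrow> complex"
  assumes "n > 0"
  shows "fps_nth ((\<Prod>j\<in>UNIV. Abs_fps (\<lambda>k. pochhammer (of_nat n * p j) k / (fact k * t j ^ k))) *
     fps_exp (- of_nat n)) (n - 1) = (- of_nat n) ^ (n - 1) / fact (n - 1) * kdf_F t p n"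
proof -
  define N where "N = n - 1"
  have n1: "1 - complex_of_nat n = - of_nat N"
    using assms by (simp add: N_def of_nat_diff)
  have n0: "complex_of_nat n \<noteq> 0"
    using assms by simp
  define c where "c k = (\<Prod>j\<in>UNIV. pochhammer (of_nat n * p j) (k j) / (fact (k j) * t j ^ k j))"
    for k :: "'m \<Rightarrow> nat"
  have "fps_nth ((\<Prod>j\<in>UNIV. Abs_fps (\<lambda>k. pochhammer (of_nat n * p j) k / (fact k * t j ^ k))) *
      fps_exp (- of_nat n)) N =
      (\<Sum>i\<le>N. (\<Sum>k | (\<Sum>j\<in>UNIV. k j) = i. c k) * ((- of_nat n) ^ (N - i) / fact (N - i)))"
    by (simp add: fps_mult_nth fps_nth_prod_multi_index c_def atLeast0AtMost)
  also have "\<dots> = (\<Sum>i\<le>N. \<Sum>k | k \<in> {k. (\<Sum>j\<in>UNIV. k j) \<le> N} \<and> (\<Sum>j\<in>UNIV. k j) = i.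
      c k * ((- of_nat n) ^ (N - (\<Sum>j\<in>UNIV. k j)) / fact (N - (\<Sum>j\<in>UNIV. k j))))"
    unfolding sum_distrib_right by (intro sum.cong refl) auto
  also have "\<dots> = (\<Sum>k | (\<Sum>j\<in>UNIV. k j) \<le> N.
      c k * ((- of_nat n) ^ (N - (\<Sum>j\<in>UNIV. k j)) / fact (N - (\<Sum>j\<in>UNIV. k j))))"
    by (rule sum.group) (auto simp: finite_multi_index_le)
  also have "\<dots> = (\<Sum>k | (\<Sum>j\<in>UNIV. k j) \<le> N. (- of_nat n) ^ N / fact N *
      (pochhammer (- of_nat N) (\<Sum>j\<in>UNIV. k j) *
      (\<Prod>j\<in>UNIV. pochhammer (of_nat n * p j) (k j) * ((1 / (of_nat n * t j)) ^ k j / fact (k j)))))"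
  proof (rule sum.cong[OF refl])
    fix k :: "'m \<Rightarrow> nat" assume "k \<in> {k. (\<Sum>j\<in>UNIV. k j) \<le> N}"
    then have le: "(\<Sum>j\<in>UNIV. k j) \<le> N"
      by simp
    define s where "s = (\<Sum>j\<in>UNIV. k j)"
    have "(\<Prod>j\<in>UNIV. pochhammer (of_nat n * p j) (k j) * ((1 / (of_nat n * t j)) ^ k j / fact (k j)))
        = c k / of_nat n ^ s"
      by (simp add: c_def s_def power_sum prod_dividef[symmetric] power_divide power_mult_distrib mult_ac)
    moreover have "(- of_nat n :: complex) ^ N = (- of_nat n) ^ (N - s) * ((-1) ^ s * of_nat n ^ s)"
      using le by (simp add: s_def flip: power_add power_minus)
    moreover have "(-1::complex) ^ s * (-1) ^ s = 1"
      by (simp flip: power_mult_distrib)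
    ultimately show "c k * ((- of_nat n) ^ (N - (\<Sum>j\<in>UNIV. k j)) / fact (N - (\<Sum>j\<in>UNIV. k j))) =
      (- of_nat n) ^ N / fact N * (pochhammer (- of_nat N) (\<Sum>j\<in>UNIV. k j) *
      (\<Prod>j\<in>UNIV. pochhammer (of_nat n * p j) (k j) * ((1 / (of_nat n * t j)) ^ k j / fact (k j))))"
      using n0 unfolding s_def[symmetric]
      by (simp add: pochhammer_minus_of_nat_eq_fact[OF le, folded s_def] field_simps)
  qed
  also have "\<dots> = (- of_nat n) ^ N / fact N * kdf_F t p n"
    unfolding kdf_F_def n1 kampe_de_feriet_finite_sum sum_distrib_left by simp
  finally show ?thesis
    unfolding N_def .
qed

theorem branch_fun_inverse_expansion:
  fixes t p :: "'m::finite \<Rightarrow> complex"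
  assumes t: "\<And>j. t j \<noteq> 0"
    and f: "eventually (\<lambda>z. f z = branch_fun t p z) (nhds 0)"
  shows "\<exists>g. is_inverse_near_0 f g"
    and "is_inverse_near_0 f g \<Longrightarrow> g has_fps_expansion Abs_fps (\<lambda>n. if n = 0 then 0 else
          (- of_nat n) ^ (n - 1) / fact n *
          (\<Prod>j\<in>UNIV. (- t j) powr (- of_nat n * p j)) * kdf_F t p n)"
proof -
  define \<Phi> where "\<Phi> = fps_expansion (branch_cofactor t p) 0"
  have \<Phi>: "branch_cofactor t p has_fps_expansion \<Phi>"
    unfolding \<Phi>_def by (rule analytic_at_imp_has_fps_expansion_0[OF branch_cofactor_analytic])
  have \<Phi>0: "fps_nth \<Phi> 0 \<noteq> 0"
    using t by (simp add: branch_cofactor_def flip: has_fps_expansion_imp_0_eq_fps_nth_0[OF \<Phi>])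
  have "(\<lambda>z. z * branch_cofactor t p z) has_fps_expansion fps_X * \<Phi>"
    by (intro fps_expansion_intros \<Phi>)
  moreover have "eventually (\<lambda>z. f z = z * branch_cofactor t p z) (nhds 0)"
    using f by eventually_elim (simp add: branch_fun_def branch_cofactor_def)
  ultimately have F: "f has_fps_expansion fps_X * \<Phi>"
    using has_fps_expansion_cong[of f "\<lambda>z. z * branch_cofactor t p z", OF _ refl] by simp
  show "\<exists>g. is_inverse_near_0 f g"
    by (rule is_inverse_near_0_exists[OF F]) (use \<Phi>0 in auto)
  have pow: "inverse \<Phi> ^ n = fps_const (\<Prod>j\<in>UNIV. (- t j) powr (- of_nat n * p j)) *
    ((\<Prod>j\<in>UNIV. Abs_fps (\<lambda>k. pochhammer (of_nat n * p j) k / (fact k * t j ^ k))) *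
     fps_exp (- of_nat n))" if "n > 0" for n
    by (rule fps_expansion_unique_complex[OF _ inverse_branch_cofactor_power_expansion[OF that]])
      (intro fps_expansion_intros \<Phi> \<Phi>0)
  have "fps_nth (inverse \<Phi> ^ n) (n - 1) / of_nat n =
      (- of_nat n) ^ (n - 1) / fact n *
      (\<Prod>j\<in>UNIV. (- t j) powr (- of_nat n * p j)) * kdf_F t p n" if "n > 0" for n
  proof -
    have "(fact n :: complex) = of_nat n * fact (n - 1)"
      using that by (simp add: fact_reduce)
    then show ?thesis
      unfolding pow[OF that] fps_mult_left_const_nth nth_prod_times_exp[OF that] by (simp add: mult_ac)
  qed
  then have eq: "(\<lambda>n. if n = 0 then 0 else fps_nth (inverse \<Phi> ^ n) (n - 1) / of_nat n) =
      (\<lambda>n. if n = 0 then 0 else (- of_nat n) ^ (n - 1) / fact n *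
          (\<Prod>j\<in>UNIV. (- t j) powr (- of_nat n * p j)) * kdf_F t p n)"
    by (intro ext) simp
  show "g has_fps_expansion Abs_fps (\<lambda>n. if n = 0 then 0 else
          (- of_nat n) ^ (n - 1) / fact n *
          (\<Prod>j\<in>UNIV. (- t j) powr (- of_nat n * p j)) * kdf_F t p n)" if "is_inverse_near_0 f g"
    using lagrange_inversion_analytic[OF F \<Phi>0 that] unfolding eq .
qed

section \<open>Principal values\<close>

text \<open>
  Splitting \<open>z - t = (- t) (1 - z/t)\<close> under the principal power costs no correction factor near
  \<open>z = 0\<close>, unless \<open>- t\<close> lies on the branch cut and \<open>z\<close> below the real axis.
\<close>

lemma eventually_shifted_powr:
  fixes t p :: complex
  assumes t: "t \<noteq> 0"
  shows "eventually (\<lambda>z. (z - t) powr p = (- t) powr p * (1 - z / t) powr p *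
    (if Im z < 0 then exp (- 2 * of_real pi * \<i> * (if - t \<in> \<real>\<^sub>\<le>\<^sub>0 then p else 0)) else 1)) (nhds 0)"
proof -
  define L where "L z = Ln (1 - z / t)" for z
  have lim: "((\<lambda>z. 1 - z / t) \<longlongrightarrow> 1 - 0 / t) (nhds 0)"
    by (intro tendsto_intros filterlim_ident) (use t in auto)
  have "((\<lambda>z. Re (1 - z / t)) \<longlongrightarrow> Re (1 - 0 / t)) (nhds 0)"
    by (intro tendsto_Re lim)
  then have re: "eventually (\<lambda>z. Re (1 - z / t) > 0) (nhds 0)"
    by (rule order_tendstoD) simp
  have "(L \<longlongrightarrow> Ln (1 - 0 / t)) (nhds 0)"
    unfolding L_def by (intro tendsto_Ln lim) auto
  then have imL: "((\<lambda>z. Im (L z)) \<longlongrightarrow> 0) (nhds 0)"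
    using tendsto_Im by fastforce
  have split: "z - t = - t * (1 - z / t)" for z
    using t by (simp add: field_simps)
  show ?thesis
  proof (cases "- t \<in> \<real>\<^sub>\<le>\<^sub>0")
    case False
    have "- pi < Im (Ln (- t))" "Im (Ln (- t)) < pi"
      using False t mpi_less_Im_Ln[of "- t"] Im_Ln_less_pi[of "- t"]
      by (auto simp: complex_nonpos_Reals_iff complex_eq_iff)
    then have "eventually (\<lambda>z. Im (L z) > - pi - Im (Ln (- t))) (nhds 0)"
      "eventually (\<lambda>z. Im (L z) < pi - Im (Ln (- t))) (nhds 0)"
      by (auto intro!: order_tendstoD[OF imL])
    with re show ?thesis
    proof eventually_elim
      case (elim z)
      have nz: "1 - z / t \<noteq> 0"
        using elim(1) by auto
      have "Ln (z - t) = Ln (- t) + L z"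
        unfolding split[of z] L_def using elim nz t
        by (subst Ln_times_simple) (auto simp: L_def)
      moreover have "z - t \<noteq> 0"
        using split[of z] nz t by auto
      ultimately show ?case
        using False nz t by (simp add: powr_def L_def distrib_left exp_add)
    qed
  next
    \<comment> \<open>Here \<open>Ln (- t)\<close> has imaginary part exactly \<open>\<pi>\<close>, so the sum of the logarithms leaves the
      principal strip as soon as the imaginary part of \<open>Ln (1 - z/t)\<close> is positive.\<close>
    case True
    then obtain r where r: "r > 0" "t = of_real r"
      using t by (auto simp: complex_nonpos_Reals_iff complex_eq_iff intro!: that[of "Re t"])
    have imt: "Im (Ln (- t)) = pi"
      using r by (simp add: Ln_of_real' flip: of_real_minus)
    have "eventually (\<lambda>z. Im (L z) > - pi) (nhds 0)"
      by (rule order_tendstoD[OF imL]) simp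
    with re show ?thesis
    proof eventually_elim
      case (elim z)
      have nz: "1 - z / t \<noteq> 0"
        using elim(1) by auto
      have nz': "z - t \<noteq> 0"
        using split[of z] nz t by auto
      have "Im (1 - z / t) = - Im z / r"
        using r by simp
      then have "Im (1 - z / t) > 0 \<longleftrightarrow> Im z < 0"
        using r by (simp add: divide_less_0_iff)
      moreover have "0 < Im (L z) \<longleftrightarrow> 0 < Im (1 - z / t)"
        using Im_Ln_pos_lt[OF nz] Re_Ln_pos_lt[OF nz] elim(1) pi_gt_zero
        unfolding L_def by linarith
      ultimately have "Im (Ln (- t) + Ln (1 - z / t)) > pi \<longleftrightarrow> Im z < 0"
        using imt by (simp add: L_def)
      moreover have "Im (Ln (- t) + Ln (1 - z / t)) > - pi"
        using elim(2) imt pi_gt_zero unfolding L_def plus_complex.sel by linarith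
      ultimately have Ln: "Ln (z - t) = Ln (- t) + L z - (if Im z < 0 then \<i> * of_real (2 * pi) else 0)"
        unfolding split[of z] L_def by (subst Ln_times[OF _ nz]) (use t in auto)
      have "p * Ln (z - t) = p * Ln (- t) + p * L z +
          (if Im z < 0 then - 2 * of_real pi * \<i> * p else 0)"
        unfolding Ln by (simp add: algebra_simps)
      then have "exp (p * Ln (z - t)) = exp (p * Ln (- t)) * exp (p * L z) *
          (if Im z < 0 then exp (- 2 * of_real pi * \<i> * p) else 1)"
        by (simp only: exp_add) simp
      then show ?case
        using True nz nz' t by (simp add: powr_def L_def)
    qed
  qed
qed

lemma principal_fun_eq_branch_fun:
  fixes t p :: "'m::finite \<Rightarrow> complex"
  assumes t: "\<And>j. t j \<noteq> 0" and reg: "principal_regular t p"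
  shows "eventually (\<lambda>z. principal_fun t p z = branch_fun t p z) (nhds 0)"
proof -
  obtain N :: int where N: "(\<Sum>j | - t j \<in> \<real>\<^sub>\<le>\<^sub>0. p j) = of_int N"
    using reg by (auto simp: principal_regular_def elim: Ints_cases)
  have "(\<Prod>j\<in>UNIV. exp (- 2 * of_real pi * \<i> * (if - t j \<in> \<real>\<^sub>\<le>\<^sub>0 then p j else 0))) =
      exp (- 2 * of_real pi * \<i> * (\<Sum>j\<in>UNIV. if - t j \<in> \<real>\<^sub>\<le>\<^sub>0 then p j else 0))"
    by (simp only: exp_sum[OF finite] sum_distrib_left)
  also have "(\<Sum>j\<in>UNIV. if - t j \<in> \<real>\<^sub>\<le>\<^sub>0 then p j else 0) = of_int N"
    unfolding N[symmetric] by (simp add: sum.If_cases)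
  also have "exp (- 2 * of_real pi * \<i> * of_int N) = (1 :: complex)"
    by (auto simp: exp_eq_1 intro!: exI[of _ "- N"])
  finally have one: "(\<Prod>j\<in>UNIV. exp (- 2 * of_real pi * \<i> * (if - t j \<in> \<real>\<^sub>\<le>\<^sub>0 then p j else 0))) = 1" .
  have "eventually (\<lambda>z. \<forall>j\<in>UNIV. (z - t j) powr p j = (- t j) powr p j * (1 - z / t j) powr p j *
    (if Im z < 0 then exp (- 2 * of_real pi * \<i> * (if - t j \<in> \<real>\<^sub>\<le>\<^sub>0 then p j else 0)) else 1)) (nhds 0)"
    by (intro eventually_ball_finite ballI eventually_shifted_powr t) simp
  then show ?thesis
  proof eventually_elim
    case (elim z)
    then have "(\<Prod>j\<in>UNIV. (z - t j) powr p j) =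
        (\<Prod>j\<in>UNIV. (- t j) powr p j * (1 - z / t j) powr p j *
          (if Im z < 0 then exp (- 2 * of_real pi * \<i> * (if - t j \<in> \<real>\<^sub>\<le>\<^sub>0 then p j else 0)) else 1))"
      by (intro prod.cong refl) blast
    also have "\<dots> = (\<Prod>j\<in>UNIV. (- t j) powr p j * (1 - z / t j) powr p j) *
        (\<Prod>j\<in>UNIV. if Im z < 0 then exp (- 2 * of_real pi * \<i> * (if - t j \<in> \<real>\<^sub>\<le>\<^sub>0 then p j else 0)) else 1)"
      by (simp only: prod.distrib)
    also have "(\<Prod>j\<in>UNIV. if Im z < 0 then exp (- 2 * of_real pi * \<i> * (if - t j \<in> \<real>\<^sub>\<le>\<^sub>0 then p j else 0)) else 1) = 1"
      using one by (cases "Im z < 0") simp_all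
    finally show ?case
      by (simp add: principal_fun_def branch_fun_def)
  qed
qed

section \<open>The inverse function and its coefficients\<close>

theorem theorem1p1:
  fixes t p :: "'m::finite \<Rightarrow> complex"
    and f :: "complex \<Rightarrow> complex"
  assumes t_nonzero: "\<And>j. t j \<noteq> 0"
    and p_nonzero: "\<And>j. p j \<noteq> 0"
    and f: "(f = principal_fun t p \<and> principal_regular t p) \<or> f = branch_fun t p"
  shows
    "(\<exists>g. is_inverse_near_0 f g) \<and>
     (\<forall>g. is_inverse_near_0 f g \<longrightarrow>
        g has_fps_expansion Abs_fps (\<lambda>n. if n = 0 then 0 else
          (- of_nat n) ^ (n - 1) / fact n *
          (\<Prod>j\<in>UNIV. (- t j) powr (- of_nat n * p j)) * kdf_F t p n)) \<and>
     (\<forall>n\<ge>1.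
        ((\<lambda>k::'m \<Rightarrow> nat.
            pochhammer (1 - of_nat n) (\<Sum>j\<in>UNIV. k j) *
            (\<Prod>j\<in>UNIV. pochhammer (of_nat n * p j) (k j)) /
            ((\<Prod>j\<in>UNIV. fact (k j)) * (\<Prod>j\<in>UNIV. (of_nat n * t j) ^ k j)))
          has_sum kdf_F t p n) UNIV \<and>
        ((\<lambda>c. lauricella_FD (1 - of_nat n) (\<lambda>j. of_nat n * p j) c
                (\<lambda>j. c * (1 / (of_nat n * t j)))) \<longlongrightarrow> kdf_F t p n) at_infinity \<and>
        mpoly_fun_degree_le (n - 1)
          (\<lambda>x. kampe_de_feriet (1 - of_nat n) (\<lambda>j. of_nat n * p j) x) \<and>
        (\<not> (\<exists>a::'m \<Rightarrow> nat. (\<forall>j. of_nat n * p j = - of_nat (a j)) \<and> (\<Sum>j\<in>UNIV. a j) < n - 1) \<longrightarrow>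
          mpoly_fun_degree_eq (n - 1)
            (\<lambda>x. kampe_de_feriet (1 - of_nat n) (\<lambda>j. of_nat n * p j) x)))"
proof (intro conjI allI impI)
  have "eventually (\<lambda>z. f z = branch_fun t p z) (nhds 0)"
    using f principal_fun_eq_branch_fun[OF t_nonzero] by auto
  note inverse = branch_fun_inverse_expansion[OF t_nonzero this]
  show "\<exists>g. is_inverse_near_0 f g"
    by (rule inverse(1))
  show "g has_fps_expansion Abs_fps (\<lambda>n. if n = 0 then 0 else
          (- of_nat n) ^ (n - 1) / fact n *
          (\<Prod>j\<in>UNIV. (- t j) powr (- of_nat n * p j)) * kdf_F t p n)"
    if "is_inverse_near_0 f g" for g
    using that by (rule inverse(2))
next
  fix n :: nat assume "1 \<le> n"
  then have a: "1 - complex_of_nat n = - of_nat (n - 1)"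
    by (simp add: of_nat_diff)
  show "((\<lambda>k::'m \<Rightarrow> nat.
            pochhammer (1 - of_nat n) (\<Sum>j\<in>UNIV. k j) *
            (\<Prod>j\<in>UNIV. pochhammer (of_nat n * p j) (k j)) /
            ((\<Prod>j\<in>UNIV. fact (k j)) * (\<Prod>j\<in>UNIV. (of_nat n * t j) ^ k j)))
          has_sum kdf_F t p n) UNIV"
    using kampe_de_feriet_has_sum[of "n - 1" "\<lambda>j. of_nat n * p j" "\<lambda>j. 1 / (of_nat n * t j)"]
    unfolding kdf_F_def a
    by (simp add: prod.distrib prod_dividef power_one_over field_simps)
  show "((\<lambda>c. lauricella_FD (1 - of_nat n) (\<lambda>j. of_nat n * p j) c
                (\<lambda>j. c * (1 / (of_nat n * t j)))) \<longlongrightarrow> kdf_F t p n) at_infinity"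
    unfolding kdf_F_def a by (rule lauricella_FD_tendsto_kampe_de_feriet)
  show "mpoly_fun_degree_le (n - 1)
          (\<lambda>x. kampe_de_feriet (1 - of_nat n) (\<lambda>j. of_nat n * p j) x)"
    unfolding a by (rule kampe_de_feriet_degree_le)
  show "mpoly_fun_degree_eq (n - 1)
            (\<lambda>x. kampe_de_feriet (1 - of_nat n) (\<lambda>j. of_nat n * p j) x)"
    if "\<not> (\<exists>a::'m \<Rightarrow> nat. (\<forall>j. of_nat n * p j = - of_nat (a j)) \<and> (\<Sum>j\<in>UNIV. a j) < n - 1)"
    using that unfolding a by (rule kampe_de_feriet_degree_eq)
qed


end
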